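(* Let $g(k)$ denote the number of rational points of denominator $k$ in the half-open cube $(0,1]^n$. For every Riemann-integrable function $f$ (complex-valued, bounded, with compact support, defined on a subset of $\mathbb{R}^n$ and extended by $0$ outside its domain) we have $$\int_{\mathbb{R}^n} f\,d\bar x=\lim_{k\to\infty}\frac{1}{g(k)}\sum_{u\in\mathbb{Q}^n,\ \mathrm{den}(u)=k} f(u).$$
   Context: Every $u\in\mathbb{Q}^n$ can be written uniquely as $u=(a_1/k,\ldots,a_n/k)$ with $a_1,\ldots,a_n,k$ integers, $k\ge1$, and $\gcd(a_1,\ldots,a_n,k)=1$; then $k$ is the denominator of $u$, written $k=\mathrm{den}(u)$. *)

theory Defs
  imports "HOL-Analysis.Analysis"
begin

definition rational_points :: "(real ^ 'n) set" where
  "rational_points = {u. \<forall>i. u $ i \<in> \<rat>}"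

definition den_repr :: "real ^ 'n \<Rightarrow> ('n \<Rightarrow> int) \<Rightarrow> nat \<Rightarrow> bool" where
  "den_repr u a k \<longleftrightarrow>
     k \<ge> 1 \<and> u = (\<chi> i. of_int (a i) / of_nat k) \<and> Gcd (insert (int k) (range a)) = 1"

text \<open>Meaningful on \<open>rational_points\<close> only; see \<open>den_repr_ex\<close> and \<open>den_eqI\<close> below.\<close>

definition den :: "real ^ 'n \<Rightarrow> nat" where
  "den u = (THE k. \<exists>a. den_repr u a k)"

definition den_points :: "nat \<Rightarrow> (real ^ 'n) set" where
  "den_points k = {u \<in> rational_points. den u = k}"

definition half_open_cube :: "(real ^ 'n) set" where
  "half_open_cube = {x. \<forall>i. 0 < x $ i \<and> x $ i \<le> 1}"

definition extend_by_zero :: "'a set \<Rightarrow> ('a \<Rightarrow> 'b::zero) \<Rightarrow> 'a \<Rightarrow> 'b" where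
  "extend_by_zero D f x = (if x \<in> D then f x else 0)"

text \<open>Classical Riemann integral over a box: the Riemann sums converge as the mesh tends to 0.
  (The library's Henstock--Kurzweil integral would let the mesh bound depend on the tag.)\<close>

definition has_riemann_integral ::
    "('a::euclidean_space \<Rightarrow> 'b::real_normed_vector) \<Rightarrow> 'b \<Rightarrow> 'a \<Rightarrow> 'a \<Rightarrow> bool" where
  "has_riemann_integral f I a b \<longleftrightarrow>
     (\<forall>e>0. \<exists>d>0. \<forall>p. p tagged_division_of cbox a b \<and> (\<forall>(x, K)\<in>p. diameter K < d) \<longrightarrow>
        norm ((\<Sum>(x, K)\<in>p. measure lborel K *\<^sub>R f x) - I) < e)"

text \<open>Riemann integrability on the whole space, for bounded functions with compact support:
  integrability over a box outside of which the function vanishes (the choice of the box is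
  immaterial).\<close>

definition riemann_integrable ::
    "('a::euclidean_space \<Rightarrow> 'b::real_normed_vector) \<Rightarrow> bool" where
  "riemann_integrable f \<longleftrightarrow>
     bounded (range f) \<and> compact (closure {x. f x \<noteq> 0}) \<and>
     (\<exists>a b I. {x. f x \<noteq> 0} \<subseteq> cbox a b \<and> has_riemann_integral f I a b)"

lemma den_repr_ex:
  fixes u :: "real ^ 'n"
  assumes "u \<in> rational_points"
  shows "\<exists>a k. den_repr u a k"
proof -
  have "\<forall>i. \<exists>p q. q > 0 \<and> u $ i = of_int p / of_int q"
    using assms unfolding rational_points_def by (metis Rats_cases' mem_Collect_eq)
  then obtain p q where pq: "\<And>i. q i > (0::int)" "\<And>i. u $ i = of_int (p i) / of_int (q i)"
    by metis
  define Q where "Q = (\<Prod>i\<in>UNIV. q i)"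
  have Q: "Q > 0" unfolding Q_def using pq by (simp add: prod_pos)
  define b where "b i = p i * (Q div q i)" for i
  have dv: "q i dvd Q" for i unfolding Q_def by (simp add: dvd_prodI)
  have ub: "u $ i = of_int (b i) / of_int Q" for i
  proof -
    obtain r where r: "Q = q i * r" using dv by (auto elim: dvdE)
    have "r \<noteq> 0" using Q r by auto
    moreover have "q i \<noteq> 0" using pq(1)[of i] by simp
    ultimately show ?thesis using r by (simp add: b_def pq(2))
  qed
  define G where "G = Gcd (insert Q (range b))"
  have Gd: "G dvd Q" "\<And>i. G dvd b i" unfolding G_def by (rule Gcd_dvd, blast)+
  have "G \<noteq> 0" using Gd(1) Q by auto
  moreover have "G \<ge> 0" by (simp add: G_def)
  ultimately have G: "G > 0" by simp
  define k where "k = nat (Q div G)"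
  have k: "int k * G = Q" "k \<ge> 1"
  proof -
    obtain r where r: "Q = G * r" using Gd(1) by (auto elim: dvdE)
    then have "r > 0" using Q G by (simp add: zero_less_mult_iff)
    with r G show "int k * G = Q" "k \<ge> 1" by (auto simp: k_def)
  qed
  define a where "a i = b i div G" for i
  have a: "a i * G = b i" for i using Gd(2) by (simp add: a_def)
  have "Gcd (insert (int k) (range a)) = 1"
  proof -
    define H where "H = Gcd (insert (int k) (range a))"
    have Hd: "H dvd int k" "\<And>i. H dvd a i" unfolding H_def by (rule Gcd_dvd, blast)+
    have "H * G dvd int k * G" "\<And>i. H * G dvd a i * G" using Hd by (auto intro: mult_dvd_mono)
    then have "H * G dvd Gcd (insert Q (range b))"
      by (intro Gcd_greatest) (auto simp: k(1) a)
    then have "H * G dvd G" by (simp only: G_def)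
    then have "H dvd 1" using G by (simp add: dvd_mult_cancel_right)
    moreover have "H \<ge> 0" by (simp add: H_def)
    ultimately have "H = 1" by simp
    then show ?thesis by (simp add: H_def)
  qed
  moreover have "u = (\<chi> i. of_int (a i) / of_nat k)"
  proof -
    have "of_int (b i) / of_int Q = (of_int (a i) / of_nat k :: real)" for i
      using G by (simp flip: a k(1))
    then show ?thesis by (simp add: vec_eq_iff ub)
  qed
  ultimately show ?thesis using k(2) unfolding den_repr_def by blast
qed

lemma den_repr_unique:
  assumes "den_repr u a k" "den_repr u b l"
  shows "a = b \<and> k = l"
proof -
  have dvd: "k dvd l" if r: "den_repr u a k" "den_repr u b l" for a b k l
  proof -
    have pos: "k \<ge> 1" "l \<ge> 1" using r by (auto simp: den_repr_def)
    have cross: "int l * a i = int k * b i" for i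
    proof -
      have "of_int (a i) / of_nat k = (of_int (b i) / of_nat l :: real)"
        using r by (auto simp: den_repr_def vec_eq_iff)
      then have "real_of_int (int l * a i) = real_of_int (int k * b i)"
        using pos by (simp add: field_simps)
      then show ?thesis by (simp only: of_int_eq_iff)
    qed
    have "int k dvd Gcd ((*) (int l) ` insert (int k) (range a))"
      by (rule Gcd_greatest) (auto simp: cross)
    also have "\<dots> = int l"
    proof -
      have "Gcd ((*) (int l) ` insert (int k) (range a)) = normalize (int l * Gcd (insert (int k) (range a)))"
        by (rule Gcd_mult)
      also have "\<dots> = int l" using r unfolding den_repr_def by simp
      finally show ?thesis .
    qed
    finally show ?thesis by simp
  qed
  have kl: "k = l" using dvd assms by (meson dvd_antisym)
  moreover have "a i = b i" for i
    using assms kl by (auto simp: den_repr_def vec_eq_iff)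
  ultimately show ?thesis by auto
qed

lemma den_eqI: "den_repr u a k \<Longrightarrow> den u = k"
  unfolding den_def using den_repr_unique by blast

lemma has_riemann_integral_imp_has_integral:
  fixes f :: "'a::euclidean_space \<Rightarrow> 'b::banach"
  assumes "has_riemann_integral f I a b" "{x. f x \<noteq> 0} \<subseteq> cbox a b"
  shows "(f has_integral I) UNIV"
proof -
  have "(f has_integral I) (cbox a b)"
    unfolding has_integral
  proof (intro allI impI)
    fix e :: real assume "e > 0"
    then obtain d where d: "d > 0" and D: "\<And>p. p tagged_division_of cbox a b \<Longrightarrow>
        (\<forall>(x, K)\<in>p. diameter K < d) \<Longrightarrow> norm ((\<Sum>(x, K)\<in>p. measure lborel K *\<^sub>R f x) - I) < e"
      using assms(1) unfolding has_riemann_integral_def by metis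
    have "diameter K < d" if "K \<subseteq> ball x (d / 3)" for K and x :: 'a
    proof -
      have "diameter K \<le> diameter (ball x (d / 3))"
        using that by (intro diameter_subset) auto
      also have "\<dots> < d" using d by simp
      finally show ?thesis .
    qed
    then show "\<exists>\<gamma>. gauge \<gamma> \<and> (\<forall>p. p tagged_division_of cbox a b \<and> \<gamma> fine p \<longrightarrow>
        norm ((\<Sum>(x, K)\<in>p. measure lborel K *\<^sub>R f x) - I) < e)"
      using d by (intro exI[of _ "\<lambda>x. ball x (d / 3)"]) (auto simp: fine_def intro!: D)
  qed
  then show ?thesis
    using assms(2) by (intro has_integral_on_superset[of f I "cbox a b" UNIV]) auto
qed

end

theory Submission
  imports Defs
begin

text \<open>Points of denominator \<open>k\<close> correspond to integer vectors whose coordinates are not all divisible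
  by a common prime factor of \<open>k\<close>. Sieving by these primes, one at a time, shows that a box contains
  \<open>vol \<cdot> J\<^sub>n k + O(2 ^ \<omega> k \<cdot> k ^ (n - 1))\<close> of them, where \<open>J\<^sub>n k = k ^ n \<cdot> \<Prod>p. (1 - p ^ (- n))\<close> is Jordan's
  totient. As \<open>J\<^sub>n k \<ge> k ^ n / 2 ^ \<omega> k\<close> and \<open>4 ^ \<omega> k / k \<longlonglongrightarrow> 0\<close>, the points equidistribute with
  respect to boxes. For a fixed fine division, the normalized sum of \<open>f\<close> is then, up to a small error,
  a combination of averages of \<open>f\<close> over the cells weighted by their volumes, hence a convex combination
  of Riemann sums over that division.\<close>

section \<open>Sieving integer vectors by primes\<close>

definition sifted :: "(real ^ 'n) set \<Rightarrow> nat set \<Rightarrow> real \<Rightarrow> ('n \<Rightarrow> int) set" where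
  "sifted B P t = {a. (\<chi> i. of_int (a i) / t) \<in> B \<and> (\<forall>p\<in>P. \<exists>i. \<not> int p dvd a i)}"

text \<open>A vector in \<open>sifted B P t\<close> that fails the condition at \<open>p\<close> is
  \<open>p\<close> times a vector \<open>b\<close>, and dividing by \<open>p\<close> turns the scale
  \<open>t\<close> into \<open>t / p\<close>. The conditions at the other primes carry over to
  \<open>b\<close> because these primes are coprime to \<open>p\<close>.\<close>

lemma sifted_insert:
  fixes B :: "(real ^ 'n) set"
  assumes "\<forall>q\<in>insert p P. prime q" "p \<notin> P"
  shows "sifted B P t = sifted B (insert p P) t \<union> (\<lambda>a i. int p * a i) ` sifted B P (t / p)"
    and "sifted B (insert p P) t \<inter> (\<lambda>a i. int p * a i) ` sifted B P (t / p) = {}"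
proof -
  have p: "prime p" using assms by auto
  then have p0: "p \<noteq> 0" by auto
  have scale: "(\<lambda>i. int p * a i) \<in> sifted B P t \<longleftrightarrow> a \<in> sifted B P (t / p)" for a
  proof -
    have "int q dvd int p * a i \<longleftrightarrow> int q dvd a i" if "q \<in> P" for q i
    proof -
      have "coprime q p" using that assms p by (intro primes_coprime) auto
      then have "coprime (int q) (int p)" by simp
      then show ?thesis by (rule coprime_dvd_mult_right_iff)
    qed
    moreover have "of_int (int p * a i) / t = of_int (a i) / (t / p)" for i
      using p0 by (simp add: field_simps)
    ultimately show ?thesis by (simp add: sifted_def mult.commute)
  qed
  have "a \<in> (\<lambda>a i. int p * a i) ` sifted B P (t / p)"
    if "a \<in> sifted B P t" "a \<notin> sifted B (insert p P) t" for a
  proof -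
    have "\<forall>i. int p dvd a i" using that by (auto simp: sifted_def)
    then obtain b where "a = (\<lambda>i. int p * b i)" unfolding dvd_def by metis
    with that(1) scale show ?thesis by blast
  qed
  moreover have "sifted B (insert p P) t \<subseteq> sifted B P t" by (auto simp: sifted_def)
  ultimately show "sifted B P t = sifted B (insert p P) t \<union> (\<lambda>a i. int p * a i) ` sifted B P (t / p)"
    using scale by blast
  show "sifted B (insert p P) t \<inter> (\<lambda>a i. int p * a i) ` sifted B P (t / p) = {}"
    by (auto simp: sifted_def)
qed

text \<open>Letting \<open>t\<close> vary is what makes the induction on \<open>P\<close> work: the vectors removed by a further
  prime \<open>p\<close> form a rescaled copy of the sifted set for \<open>P\<close> at \<open>t / p\<close>.\<close>

lemma sieve_estimate:
  fixes B :: "(real ^ 'n) set" and V E T t :: real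
  assumes "finite P" "\<forall>p\<in>P. prime p"
    and base: "\<And>t. 0 < t \<Longrightarrow> t \<le> T \<Longrightarrow>
      finite (sifted B {} t) \<and> \<bar>real (card (sifted B {} t)) - t ^ n * V\<bar> \<le> E"
    and "0 < t" "t \<le> T"
  shows "\<bar>real (card (sifted B P t)) - t ^ n * V * (\<Prod>p\<in>P. 1 - 1 / real p ^ n)\<bar> \<le> 2 ^ card P * E"
  using assms(1,2,4,5)
proof (induction P arbitrary: t rule: finite_induct)
  case empty
  then show ?case using base[of t] by simp
next
  case (insert p P)
  define W where "W = (\<Prod>q\<in>P. 1 - 1 / real q ^ n)"
  have p: "p > 0" using insert.prems by (simp add: prime_gt_0_nat)
  have fin: "finite (sifted B P s)" if "0 < s" "s \<le> T" for s
    by (rule finite_subset[of _ "sifted B {} s"]) (use base[of s] that in \<open>auto simp: sifted_def\<close>)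
  \<comment> \<open>The scale only shrinks, so \<open>base\<close> stays available with the same
    \<open>E\<close>.\<close>
  have tp: "0 < t / p" "t / p \<le> T"
  proof -
    have "t / p \<le> t / 1" using p insert.prems by (intro divide_left_mono) auto
    then show "t / p \<le> T" using insert.prems by simp
  qed (use p insert.prems in simp)
  have "inj (\<lambda>a (i::'n). int p * a i)" using p by (auto simp: inj_def fun_eq_iff)
  then have "card ((\<lambda>a i. int p * a i) ` sifted B P (t / p)) = card (sifted B P (t / p))"
    by (rule card_image[OF inj_on_subset[OF _ subset_UNIV]])
  moreover have "card (sifted B P t) =
      card (sifted B (insert p P) t) + card ((\<lambda>a i. int p * a i) ` sifted B P (t / p))"
  proof -
    have "finite (sifted B P t)" using fin insert.prems by blast
    then show ?thesis
      unfolding sifted_insert(1)[OF insert.prems(1) insert.hyps(2), of B t]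
      using sifted_insert(2)[OF insert.prems(1) insert.hyps(2), of B t]
      by (intro card_Un_disjoint) auto
  qed
  ultimately have split: "real (card (sifted B (insert p P) t)) =
      real (card (sifted B P t)) - real (card (sifted B P (t / p)))" by simp
  \<comment> \<open>Subtracting the two estimates doubles the error, and
    \<open>(t / p) ^ n = t ^ n / p ^ n\<close> supplies the new factor
    \<open>1 - 1 / p ^ n\<close>.\<close>
  have "\<bar>real (card (sifted B P t)) - t ^ n * V * W\<bar> \<le> 2 ^ card P * E"
    and "\<bar>real (card (sifted B P (t / p))) - (t / p) ^ n * V * W\<bar> \<le> 2 ^ card P * E"
    using insert.IH[of t] insert.IH[of "t / p"] insert.prems tp by (simp_all add: W_def)
  moreover have "t ^ n * V * (\<Prod>q\<in>insert p P. 1 - 1 / real q ^ n) =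
      t ^ n * V * W - (t / p) ^ n * V * W"
    using insert.hyps by (simp add: W_def field_simps)
  ultimately show ?case using insert.hyps split by (simp add: algebra_simps)
qed

section \<open>Growth of powers whose exponent is the number of prime factors\<close>

text \<open>At most \<open>c\<close> prime factors lie below \<open>c\<close>, and they contribute
  at most \<open>c ^ c\<close>. Every other prime factor is at least \<open>c\<close>, so the
  remaining power of \<open>c\<close> is at most the product of those primes, hence at most
  \<open>k\<close>.\<close>

lemma power_card_prime_factors_le:
  fixes k c :: nat
  assumes "k > 0"
  shows "c ^ card (prime_factors k) \<le> c ^ c * k"
proof (cases "c = 0")
  case False
  let ?P = "prime_factors k"
  have fin: "finite ?P" by simp
  have "card {p \<in> ?P. p < c} \<le> c"
    using card_mono[of "{..<c}" "{p \<in> ?P. p < c}"] by auto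
  then have "c ^ card {p \<in> ?P. p < c} \<le> c ^ c" using False by (intro power_increasing) auto
  moreover have "c ^ card {p \<in> ?P. \<not> p < c} \<le> k"
  proof -
    have "c ^ card {p \<in> ?P. \<not> p < c} = (\<Prod>p\<in>{p \<in> ?P. \<not> p < c}. c)" by simp
    also have "\<dots> \<le> (\<Prod>p\<in>{p \<in> ?P. \<not> p < c}. p)" by (rule prod_mono) auto
    also have "\<dots> \<le> (\<Prod>p\<in>?P. p)"
      by (intro dvd_imp_le prod_dvd_prod_subset prod_pos)
         (auto simp: in_prime_factors_iff dest: prime_gt_0_nat)
    also have "\<dots> \<le> (\<Prod>p\<in>?P. p ^ multiplicity p k)"
    proof (rule prod_mono)
      fix p assume "p \<in> ?P"
      then have "multiplicity p k > 0" "p > 0"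
        by (auto simp: prime_factors_multiplicity prime_gt_0_nat)
      then show "0 \<le> p \<and> p \<le> p ^ multiplicity p k"
        by (simp add: self_le_power)
    qed
    also have "\<dots> = k" using assms by (simp add: prime_factorization_nat[symmetric])
    finally show ?thesis .
  qed
  moreover have "card ?P = card {p \<in> ?P. p < c} + card {p \<in> ?P. \<not> p < c}"
    using fin by (subst card_Un_disjoint[symmetric]) (auto intro!: arg_cong[where f = card])
  ultimately show ?thesis by (simp add: power_add mult_mono)
qed (use assms in \<open>simp add: power_0_left\<close>)

text \<open>The linear bound for the base \<open>c\<close> only gives boundedness. Applied to the
  base \<open>c\<^sup>2\<close>, it bounds the square of the numerator by a multiple of
  \<open>k\<close>, and the square root gains a factor \<open>sqrt k\<close>.\<close>

lemma power_card_prime_factors_over_tendsto_0: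
  fixes c :: nat
  shows "(\<lambda>k. real (c ^ card (prime_factors k)) / real k) \<longlonglongrightarrow> 0"
proof -
  define C where "C = sqrt (real (c\<^sup>2 ^ c\<^sup>2))"
  have "(\<lambda>k. C / sqrt (real k)) \<longlonglongrightarrow> 0"
    by (intro real_tendsto_divide_at_top[OF tendsto_const]
        filterlim_compose[OF sqrt_at_top filterlim_real_sequentially])
  moreover have "norm (real (c ^ card (prime_factors k)) / real k) \<le> C / sqrt (real k)"
    if "k > 0" for k
  proof -
    have "(real (c ^ card (prime_factors k)))\<^sup>2 = real (c\<^sup>2 ^ card (prime_factors k))"
      by (simp add: power_mult[symmetric] mult.commute)
    also have "\<dots> \<le> real (c\<^sup>2 ^ c\<^sup>2 * k)"
      using power_card_prime_factors_le[OF that, of "c\<^sup>2"] by (simp only: of_nat_le_iff)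
    also have "\<dots> = (C * sqrt k)\<^sup>2" by (simp add: C_def power_mult_distrib)
    finally have "real (c ^ card (prime_factors k)) \<le> C * sqrt k"
      by (rule power2_le_imp_le) (simp add: C_def)
    then have "real (c ^ card (prime_factors k)) / k \<le> C * sqrt k / (sqrt k * sqrt k)"
      by (simp add: divide_right_mono)
    also have "\<dots> = C / sqrt k" using that by (subst mult_divide_mult_cancel_right) auto
    finally show ?thesis by simp
  qed
  ultimately show ?thesis
    by (rule Lim_null_comparison[OF eventually_mono[OF eventually_gt_at_top[of 0]], rotated])
qed

section \<open>Lattice points in dilated boxes\<close>

text \<open>Only counts in dimension one enter, so that half-open and closed sides are treated
  alike. The error depends on \<open>T\<close> alone and is uniform in \<open>t\<close>, as the
  sieve requires.\<close>

lemma card_lattice_box_estimate: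
  fixes J :: "'n::finite \<Rightarrow> real set" and l :: "'n \<Rightarrow> real" and C T t :: real
  assumes fin: "\<And>i t. t > 0 \<Longrightarrow> finite {m::int. of_int m / t \<in> J i}"
    and cnt: "\<And>i t. t > 0 \<Longrightarrow> \<bar>real (card {m::int. of_int m / t \<in> J i}) - t * l i\<bar> \<le> 1"
    and l: "\<And>i. l i \<ge> 0" and C: "\<And>i. 1 + l i \<le> C"
    and T: "1 \<le> T" and t: "0 < t" "t \<le> T"
  shows "finite (sifted {x. \<forall>i. x $ i \<in> J i} {} t)"
    and "\<bar>real (card (sifted {x. \<forall>i. x $ i \<in> J i} {} t)) - t ^ CARD('n) * (\<Prod>i\<in>UNIV. l i)\<bar>
      \<le> CARD('n) * C ^ CARD('n) * T ^ CARD('n) / T"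
proof -
  define A where "A i = {m::int. of_int m / t \<in> J i}" for i
  \<comment> \<open>\<open>M\<close> dominates both \<open>t * l i\<close> and
    \<open>card (A i)\<close>. After division by \<open>M\<close> all factors lie between 0 and 1,
    where two products differ by at most the sum of the differences of their factors.\<close>
  define M where "M = C * T"
  \<comment> \<open>Types are nonempty, so \<open>undefined\<close> is an index to which the bounds
    on \<open>l\<close> apply.\<close>
  have C1: "C \<ge> 1" using C[of undefined] l[of undefined] by linarith
  have TM: "T \<le> M" using mult_right_mono[OF C1, of T] T by (simp add: M_def)
  have M: "M > 0" using TM T by linarith
  have S: "sifted {x. \<forall>i. x $ i \<in> J i} {} t = PiE UNIV A"
    by (auto simp: sifted_def A_def PiE_UNIV_domain)
  show "finite (sifted {x. \<forall>i. x $ i \<in> J i} {} t)"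
    unfolding S using fin[OF t(1)] by (intro finite_PiE) (auto simp: A_def)
  have tl: "t * l i + 1 \<le> M" for i
  proof -
    have "t * l i \<le> T * l i" using t l by (intro mult_right_mono) auto
    moreover have "T * (1 + l i) \<le> T * C" using C T by (intro mult_left_mono) auto
    ultimately show ?thesis using T by (simp add: M_def algebra_simps)
  qed
  have cA: "\<bar>real (card (A i)) - t * l i\<bar> \<le> 1" for i using cnt[OF t(1)] by (simp add: A_def)
  have "\<bar>(\<Prod>i\<in>UNIV. real (card (A i)) / M) - (\<Prod>i\<in>UNIV. t * l i / M)\<bar>
      \<le> (\<Sum>i\<in>UNIV. \<bar>real (card (A i)) / M - t * l i / M\<bar>)"
  proof -
    have "\<bar>real (card (A i)) / M\<bar> \<le> 1" for i
      using cA[of i] tl[of i] M by (simp add: divide_simps)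
    moreover have "\<bar>t * l i / M\<bar> \<le> 1" for i
      using tl[of i] M t l[of i] by (simp add: divide_simps)
    ultimately show ?thesis
      using norm_prod_diff[of UNIV "\<lambda>i. real (card (A i)) / M" "\<lambda>i. t * l i / M"]
      by simp
  qed
  also have "\<dots> \<le> (\<Sum>i\<in>(UNIV::'n set). 1 / M)"
  proof (rule sum_mono)
    fix i
    have "\<bar>real (card (A i)) / M - t * l i / M\<bar> = \<bar>real (card (A i)) - t * l i\<bar> / M"
      using M by (simp add: diff_divide_distrib[symmetric])
    also have "\<dots> \<le> 1 / M" using cA[of i] M by (intro divide_right_mono) auto
    finally show "\<bar>real (card (A i)) / M - t * l i / M\<bar> \<le> 1 / M" .
  qed
  finally have "\<bar>(\<Prod>i\<in>UNIV. real (card (A i))) - (\<Prod>i\<in>UNIV. t * l i)\<bar> / M ^ CARD('n) \<le> CARD('n) / M"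
    using M by (simp add: prod_dividef diff_divide_distrib[symmetric])
  then have "\<bar>(\<Prod>i\<in>UNIV. real (card (A i))) - (\<Prod>i\<in>UNIV. t * l i)\<bar> \<le> CARD('n) / M * M ^ CARD('n)"
    using M by (simp add: pos_divide_le_eq)
  also have "\<dots> \<le> CARD('n) / T * M ^ CARD('n)"
    using TM T M by (intro mult_right_mono divide_left_mono) auto
  finally show "\<bar>real (card (sifted {x. \<forall>i. x $ i \<in> J i} {} t)) - t ^ CARD('n) * (\<Prod>i\<in>UNIV. l i)\<bar>
      \<le> CARD('n) * C ^ CARD('n) * T ^ CARD('n) / T"
    unfolding S by (simp add: card_PiE prod.distrib M_def power_mult_distrib)
qed

section \<open>Points of denominator \<open>k\<close> as sifted vectors\<close>

lemma den_points_repr: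
  assumes "u \<in> den_points k"
  shows "\<exists>a. den_repr u a k"
  using assms den_repr_ex[of u] den_eqI unfolding den_points_def by blast

lemma finite_den_points_cbox: "finite (den_points k \<inter> cbox a b)"
proof (rule finite_subset)
  let ?A = "PiE UNIV (\<lambda>i. {\<lceil>k * a $ i\<rceil>..\<lfloor>k * b $ i\<rfloor>})"
  show "den_points k \<inter> cbox a b \<subseteq> (\<lambda>m. \<chi> i. of_int (m i) / real k) ` ?A"
  proof
    fix u assume u: "u \<in> den_points k \<inter> cbox a b"
    then obtain m where m: "den_repr u m k" using den_points_repr by blast
    then have k: "real k > 0" and um: "u = (\<chi> i. of_int (m i) / real k)"
      by (auto simp: den_repr_def)
    have "m i \<in> {\<lceil>k * a $ i\<rceil>..\<lfloor>k * b $ i\<rfloor>}" for i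
    proof -
      have "a $ i \<le> of_int (m i) / real k" "of_int (m i) / real k \<le> b $ i"
        using u by (simp_all add: mem_box_cart um)
      with k show ?thesis
        by (simp add: ceiling_le_iff le_floor_iff pos_le_divide_eq pos_divide_le_eq mult.commute)
    qed
    then show "u \<in> (\<lambda>m. \<chi> i. of_int (m i) / real k) ` ?A"
      unfolding um by (intro imageI) (simp add: PiE_UNIV_domain)
  qed
qed (simp add: finite_PiE)

text \<open>A gcd other than 1 has a prime divisor, which then divides \<open>k\<close> as well; so
  lowest terms need only be tested at the prime factors of \<open>k\<close>.\<close>

lemma bij_betw_sifted_den_points:
  fixes B :: "(real ^ 'n) set"
  assumes k: "k > 0"
  shows "bij_betw (\<lambda>a. \<chi> i. of_int (a i) / real k) (sifted B (prime_factors k) (real k)) (den_points k \<inter> B)"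
proof -
  have repr: "den_repr (\<chi> i. of_int (a i) / real k) a k \<longleftrightarrow> (\<forall>p\<in>prime_factors k. \<exists>i. \<not> int p dvd a i)"
    for a :: "'n \<Rightarrow> int"
  proof -
    define G where "G = Gcd (insert (int k) (range a))"
    have Gd: "G dvd int k" "\<And>i. G dvd a i" unfolding G_def by (rule Gcd_dvd, blast)+
    have G0: "G \<ge> 0" by (simp add: G_def)
    have "G = 1 \<longleftrightarrow> (\<forall>p\<in>prime_factors k. \<exists>i. \<not> int p dvd a i)"
    proof
      assume G1: "G = 1"
      show "\<forall>p\<in>prime_factors k. \<exists>i. \<not> int p dvd a i"
      proof (rule ccontr)
        assume "\<not> ?thesis"
        then obtain p where p: "p \<in> prime_factors k" "\<And>i. int p dvd a i" by blast
        then have "int p dvd G" unfolding G_def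
          by (intro Gcd_greatest) (auto simp: in_prime_factors_iff)
        with G1 p(1) show False by (auto simp: in_prime_factors_iff)
      qed
    next
      assume *: "\<forall>p\<in>prime_factors k. \<exists>i. \<not> int p dvd a i"
      show "G = 1"
      proof (rule ccontr)
        assume "G \<noteq> 1"
        then have "nat G \<noteq> 1" using G0 by auto
        then obtain p where p: "prime p" "p dvd nat G" using prime_factor_nat by blast
        then have pG: "int p dvd G" using G0 by (metis int_dvd_int_iff nat_0_le)
        then have "p dvd k" using Gd(1) by (meson dvd_trans int_dvd_int_iff)
        then have "p \<in> prime_factors k" using p(1) k by (simp add: in_prime_factors_iff)
        with * pG Gd(2) show False by (meson dvd_trans)
      qed
    qed
    then show ?thesis using k by (simp add: den_repr_def G_def)
  qed
  show ?thesis unfolding bij_betw_def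
  proof
    show "inj_on (\<lambda>a. \<chi> i. of_int (a i) / real k) (sifted B (prime_factors k) (real k))"
      using k by (auto simp: inj_on_def vec_eq_iff fun_eq_iff)
    show "(\<lambda>a. \<chi> i. of_int (a i) / real k) ` sifted B (prime_factors k) (real k) = den_points k \<inter> B"
    proof (intro equalityI subsetI)
      fix u assume "u \<in> (\<lambda>a. \<chi> i. of_int (a i) / real k) ` sifted B (prime_factors k) (real k)"
      then obtain a where a: "a \<in> sifted B (prime_factors k) (real k)" "u = (\<chi> i. of_int (a i) / real k)"
        by blast
      then have "den_repr u a k" using repr[of a] by (simp add: sifted_def)
      then have "den u = k" by (rule den_eqI)
      moreover have "u \<in> rational_points" using a by (simp add: rational_points_def)
      moreover have "u \<in> B" using a by (simp add: sifted_def)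
      ultimately show "u \<in> den_points k \<inter> B" by (simp add: den_points_def)
    next
      fix u assume u: "u \<in> den_points k \<inter> B"
      then obtain a where r: "den_repr u a k" using den_points_repr by blast
      then have ua: "u = (\<chi> i. of_int (a i) / real k)" by (simp add: den_repr_def)
      then have "a \<in> sifted B (prime_factors k) (real k)"
        using repr[of a] r u by (simp add: sifted_def)
      with ua show "u \<in> (\<lambda>a. \<chi> i. of_int (a i) / real k) ` sifted B (prime_factors k) (real k)" by blast
    qed
  qed
qed

section \<open>Jordan's totient and its lower bound\<close>

text \<open>\<^term>\<open>jordan_totient n k\<close> is the exact number of points of denominator \<^term>\<open>k\<close> in the unit cube,
  but only the asymptotic equality is needed.\<close>

definition jordan_totient :: "nat \<Rightarrow> nat \<Rightarrow> real" where
  "jordan_totient n k = real k ^ n * (\<Prod>p\<in>prime_factors k. 1 - 1 / real p ^ n)"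

text \<open>Since \<open>n \<ge> 1\<close>, each \<open>p ^ n\<close> is at least 2, so every factor
  of the product is at least 1/2. This lower bound controls the relative error of the sieve.\<close>

lemma jordan_totient_ge:
  assumes "n \<ge> 1"
  shows "real k ^ n / 2 ^ card (prime_factors k) \<le> jordan_totient n k"
proof -
  have "1 / 2 ^ card (prime_factors k) = (\<Prod>p\<in>prime_factors k. 1 / 2 :: real)"
    by (simp add: power_one_over)
  also have "\<dots> \<le> (\<Prod>p\<in>prime_factors k. 1 - 1 / real p ^ n)"
  proof (rule prod_mono)
    fix p assume "p \<in> prime_factors k"
    then have p: "real p \<ge> 2" using prime_ge_2_nat by (auto simp: in_prime_factors_iff)
    have "real p ^ 1 \<le> real p ^ n" using p assms by (intro power_increasing) auto
    with p have "2 \<le> real p ^ n" by (simp only: power_one_right)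
    then have "1 / real p ^ n \<le> 1 / 2" by (simp add: divide_le_eq)
    then show "0 \<le> (1 / 2 :: real) \<and> 1 / 2 \<le> 1 - 1 / real p ^ n" by simp
  qed
  finally have "real k ^ n * (1 / 2 ^ card (prime_factors k)) \<le> jordan_totient n k"
    unfolding jordan_totient_def by (rule mult_left_mono) simp
  then show ?thesis by simp
qed

lemma jordan_totient_pos:
  assumes "n \<ge> 1" "k \<ge> 1"
  shows "jordan_totient n k > 0"
proof -
  have "real k ^ n / 2 ^ card (prime_factors k) > 0" using assms by simp
  then show ?thesis using jordan_totient_ge[OF assms(1), of k] by linarith
qed

section \<open>Equidistribution with respect to boxes\<close>

text \<open>With \<open>w\<close> distinct prime factors of \<open>k\<close>, the sieve error has
  order \<open>2 ^ w * k ^ n / k\<close>. Dividing by the totient, which is at least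
  \<open>k ^ n / 2 ^ w\<close>, leaves order \<open>4 ^ w / k\<close>, and this tends to 0.\<close>

lemma den_points_box_asymptotics:
  fixes J :: "'n::finite \<Rightarrow> real set" and l :: "'n \<Rightarrow> real"
  assumes fin: "\<And>i t. t > 0 \<Longrightarrow> finite {m::int. of_int m / t \<in> J i}"
    and cnt: "\<And>i t. t > 0 \<Longrightarrow> \<bar>real (card {m::int. of_int m / t \<in> J i}) - t * l i\<bar> \<le> 1"
    and l: "\<And>i. l i \<ge> 0"
  shows "(\<lambda>k. real (card (den_points k \<inter> {x. \<forall>i. x $ i \<in> J i})) / jordan_totient CARD('n) k)
    \<longlonglongrightarrow> (\<Prod>i\<in>UNIV. l i)"
proof -
  define B :: "(real ^ 'n) set" where "B = {x. \<forall>i. x $ i \<in> J i}"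
  define V where "V = (\<Prod>i\<in>UNIV. l i)"
  define n where "n = CARD('n)"
  have n: "n \<ge> 1" unfolding n_def by (simp add: Suc_leI)
  define C where "C = 1 + (\<Sum>i\<in>UNIV. l i)"
  have C: "1 + l i \<le> C" for i
    unfolding C_def using l by (simp add: member_le_sum)
  define D where "D = n * C ^ n"
  have D: "D \<ge> 0" unfolding D_def C_def using l by (simp add: sum_nonneg)
  have bound: "norm (real (card (den_points k \<inter> B)) / jordan_totient n k - V)
      \<le> D * (real (4 ^ card (prime_factors k)) / real k)" if k: "k \<ge> 1" for k
  proof -
    define w where "w = card (prime_factors k)"
    define J' where "J' = jordan_totient n k"
    have J0: "J' > 0" using jordan_totient_pos n k by (simp add: J'_def)
    have "card (den_points k \<inter> B) = card (sifted B (prime_factors k) (real k))"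
      using bij_betw_same_card[OF bij_betw_sifted_den_points[of k B]] k by simp
    moreover have "\<bar>real (card (sifted B (prime_factors k) (real k)))
        - real k ^ n * V * (\<Prod>p\<in>prime_factors k. 1 - 1 / real p ^ n)\<bar>
        \<le> 2 ^ w * (D * real k ^ n / real k)"
      unfolding w_def
    proof (rule sieve_estimate[where T = "real k"])
      fix t :: real assume t: "0 < t" "t \<le> real k"
      show "finite (sifted B {} t) \<and> \<bar>real (card (sifted B {} t)) - t ^ n * V\<bar>
          \<le> D * real k ^ n / real k"
        using card_lattice_box_estimate[of J l C "real k" t, OF fin cnt l C _ t] k
        by (simp add: B_def V_def D_def n_def)
    qed (use k in \<open>auto simp: in_prime_factors_iff\<close>)
    ultimately have "\<bar>real (card (den_points k \<inter> B)) - V * J'\<bar> \<le> 2 ^ w * (D * real k ^ n / real k)"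
      by (simp add: J'_def jordan_totient_def mult_ac)
    also have "\<dots> = D * (4 ^ w / real k) * (real k ^ n / 2 ^ w)"
    proof -
      have "(4::real) ^ w = 2 ^ w * 2 ^ w" by (simp add: power_mult_distrib[symmetric])
      then show ?thesis by simp
    qed
    also have "\<dots> \<le> D * (4 ^ w / real k) * J'"
      unfolding J'_def w_def using D by (intro mult_left_mono jordan_totient_ge n) auto
    finally have "\<bar>real (card (den_points k \<inter> B)) - V * J'\<bar> / J' \<le> D * (4 ^ w / real k)"
      using J0 by (simp add: pos_divide_le_eq)
    moreover have "\<bar>real (card (den_points k \<inter> B)) - V * J'\<bar> / J' =
        \<bar>real (card (den_points k \<inter> B)) / J' - V\<bar>"
      using J0 abs_divide[of "real (card (den_points k \<inter> B)) - V * J'" J']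
      by (simp add: diff_divide_distrib)
    ultimately show ?thesis by (simp add: J'_def w_def)
  qed
  have lim: "(\<lambda>k. D * (real (4 ^ card (prime_factors k)) / real k)) \<longlonglongrightarrow> 0"
    by (intro tendsto_mult_right_zero power_card_prime_factors_over_tendsto_0)
  have "\<forall>\<^sub>F k in sequentially. norm (real (card (den_points k \<inter> B)) / jordan_totient n k - V)
      \<le> D * (real (4 ^ card (prime_factors k)) / real k)"
    using eventually_ge_at_top[of 1] by eventually_elim (rule bound)
  then have "(\<lambda>k. real (card (den_points k \<inter> B)) / jordan_totient n k - V) \<longlonglongrightarrow> 0"
    using lim by (rule Lim_null_comparison)
  then show ?thesis by (simp add: B_def V_def n_def LIM_zero_iff)
qed

text \<open>Each side contributes \<open>\<lfloor>t\<rfloor>\<close> integers, within 1 of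
  \<open>t\<close>. The normalizing count of the theorem is thus asymptotic to the totient.\<close>

lemma den_points_half_open_cube_asymptotics:
  "(\<lambda>k. real (card (den_points k \<inter> half_open_cube :: (real ^ 'n) set)) / jordan_totient CARD('n) k)
    \<longlonglongrightarrow> 1"
proof -
  have eq: "{m::int. of_int m / t \<in> {0<..1::real}} = {1..\<lfloor>t\<rfloor>}" if "t > 0" for t :: real
    using that by (auto simp: zero_less_divide_iff divide_le_eq le_floor_iff)
  have "(\<lambda>k. real (card (den_points k \<inter> {x::real ^ 'n. \<forall>i. x $ i \<in> {0<..1}})) / jordan_totient CARD('n) k)
      \<longlonglongrightarrow> (\<Prod>i\<in>(UNIV::'n set). 1)"
  proof (rule den_points_box_asymptotics)
    fix t :: real assume t: "t > 0"
    show "finite {m::int. of_int m / t \<in> {0<..1::real}}" unfolding eq[OF t] by simp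
    show "\<bar>real (card {m::int. of_int m / t \<in> {0<..1::real}}) - t * 1\<bar> \<le> 1"
      unfolding eq[OF t] using t by (simp add: abs_le_iff) linarith
  qed simp
  then show ?thesis by (simp add: half_open_cube_def)
qed

lemma den_points_cbox_asymptotics:
  fixes a b :: "real ^ 'n"
  shows "(\<lambda>k. real (card (den_points k \<inter> cbox a b)) / jordan_totient CARD('n) k)
    \<longlonglongrightarrow> measure lborel (cbox a b)"
\<comment> \<open>An empty box is treated apart: the product of the \<open>b $ i - a $ i\<close>
  need not be its content.\<close>
proof (cases "cbox a b = {}")
  case False
  then have ab: "a $ i \<le> b $ i" for i by (simp add: interval_ne_empty_cart)
  have eq: "{m::int. of_int m / t \<in> {a $ i..b $ i}} = {\<lceil>t * a $ i\<rceil>..\<lfloor>t * b $ i\<rfloor>}" if "t > 0" for t i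
    using that by (auto simp: ceiling_le_iff le_floor_iff pos_le_divide_eq pos_divide_le_eq mult.commute)
  have "(\<lambda>k. real (card (den_points k \<inter> {x. \<forall>i. x $ i \<in> {a $ i..b $ i}})) / jordan_totient CARD('n) k)
      \<longlonglongrightarrow> (\<Prod>i\<in>UNIV. b $ i - a $ i)"
  proof (rule den_points_box_asymptotics)
    fix t :: real and i assume t: "t > 0"
    show "finite {m::int. of_int m / t \<in> {a $ i..b $ i}}" unfolding eq[OF t] by simp
    \<comment> \<open>This makes
      \<open>\<lfloor>t * b $ i\<rfloor> - \<lceil>t * a $ i\<rceil> + 1\<close> nonnegative, so
      \<open>nat\<close> in the cardinality formula truncates nothing.\<close>
    have "t * a $ i \<le> t * b $ i" using t ab by (intro mult_left_mono) auto
    then show "\<bar>real (card {m::int. of_int m / t \<in> {a $ i..b $ i}}) - t * (b $ i - a $ i)\<bar> \<le> 1"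
      unfolding eq[OF t] card_atLeastAtMost_int right_diff_distrib by linarith
  qed (use ab in simp)
  moreover have "cbox a b = {x. \<forall>i. x $ i \<in> {a $ i..b $ i}}" by (auto simp: mem_box_cart)
  ultimately show ?thesis unfolding content_cbox_cart[OF False] by (simp only:)
qed simp

text \<open>Both counts are normalized by the same totient, nonzero for \<open>k \<ge> 1\<close>,
  which cancels in the quotient of the two limits.\<close>

lemma den_points_cbox_density:
  fixes a b :: "real ^ 'n"
  shows "(\<lambda>k. real (card (den_points k \<inter> cbox a b)) / real (card (den_points k \<inter> half_open_cube :: (real ^ 'n) set)))
    \<longlonglongrightarrow> measure lborel (cbox a b)"
proof -
  let ?J = "jordan_totient CARD('n)"
  have lim: "(\<lambda>k. (real (card (den_points k \<inter> cbox a b)) / ?J k)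
        / (real (card (den_points k \<inter> half_open_cube :: (real ^ 'n) set)) / ?J k))
      \<longlonglongrightarrow> measure lborel (cbox a b) / 1"
    by (intro tendsto_divide den_points_cbox_asymptotics den_points_half_open_cube_asymptotics) simp
  have nonzero: "?J k \<noteq> 0" if "k \<ge> 1" for k
    using jordan_totient_pos[of "CARD('n)" k] that by (simp add: Suc_leI)
  have "\<forall>\<^sub>F k in sequentially. (real (card (den_points k \<inter> cbox a b)) / ?J k)
        / (real (card (den_points k \<inter> half_open_cube :: (real ^ 'n) set)) / ?J k)
      = real (card (den_points k \<inter> cbox a b)) / real (card (den_points k \<inter> half_open_cube :: (real ^ 'n) set))"
    using eventually_ge_at_top[of 1] by eventually_elim (simp add: nonzero)
  with lim show ?thesis by (simp only: div_by_1 Lim_transform_eventually)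
qed

section \<open>From equidistribution to Riemann integrals\<close>

text \<open>Meant for the closed cells of a division, which may share faces: points counted
  repeatedly only enlarge the right side, as \<open>h\<close> is nonnegative.\<close>

lemma sum_Union_le:
  fixes h :: "'a \<Rightarrow> real"
  assumes "finite Q" "\<And>K. K \<in> Q \<Longrightarrow> finite (U K)" "\<And>x. h x \<ge> 0"
  shows "sum h (\<Union>K\<in>Q. U K) \<le> (\<Sum>K\<in>Q. sum h (U K))"
  using assms(1,2)
proof (induction Q rule: finite_induct)
  case (insert K Q)
  have "sum h (U K \<union> (\<Union>K\<in>Q. U K)) \<le> sum h (U K) + sum h (\<Union>K\<in>Q. U K)"
    using insert assms(3) by (subst sum_Un) (auto intro: sum_nonneg)
  then show ?case using insert by simp
qed simp

text \<open>The mesh bound of the classical Riemann integral is independent of the tags. So the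
  division \<open>Q\<close> is fixed first, and the tags are chosen afterwards for each
  \<open>k\<close>, adapted to the error at that \<open>k\<close>. The inner product serves to test
  this error along its own direction.\<close>

lemma equidistributed_sums_tendsto_riemann_integral:
  fixes f :: "'a::euclidean_space \<Rightarrow> 'b::real_inner" and X :: "nat \<Rightarrow> 'a set" and g :: "nat \<Rightarrow> real"
  assumes f: "has_riemann_integral f I a b" "bounded (range f)"
    and g: "\<And>k. g k \<ge> 0"
    and fin: "\<And>k. finite (X k \<inter> cbox a b)"
    and dens: "\<And>c d. (\<lambda>k. real (card (X k \<inter> cbox c d)) / g k) \<longlonglongrightarrow> measure lborel (cbox c d)"
  shows "(\<lambda>k. (\<Sum>u\<in>X k \<inter> cbox a b. f u) /\<^sub>R g k) \<longlonglongrightarrow> I"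
proof (rule tendstoI)
  fix e :: real assume e: "e > 0"
  obtain B where B: "\<And>x. norm (f x) \<le> B" using f(2) by (auto simp: bounded_iff)
  have B0: "B \<ge> 0" using B[of undefined] norm_ge_zero[of "f undefined"] by linarith
  obtain d where d: "d > 0" and D: "\<And>p. p tagged_division_of cbox a b \<Longrightarrow>
        (\<forall>(x, K)\<in>p. diameter K < d) \<Longrightarrow> norm ((\<Sum>(x, K)\<in>p. measure lborel K *\<^sub>R f x) - I) < e / 2"
    using f(1) e unfolding has_riemann_integral_def by (metis half_gt_zero)
  \<comment> \<open>Only the cells of \<open>p\<close> will be used; balls of radius
    \<open>d / 3\<close> keep their diameters below \<open>d\<close>.\<close>
  have "gauge (\<lambda>x::'a. ball x (d / 3))" using d by auto
  then obtain p where p: "p tagged_division_of cbox a b" "(\<lambda>x. ball x (d / 3)) fine p"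
    using fine_division_exists by blast
  define Q where "Q = snd ` p"
  have Q: "Q division_of cbox a b" unfolding Q_def using p(1) by (rule division_of_tagged_division)
  have finQ: "finite Q" and UQ: "\<Union>Q = cbox a b" using Q by auto
  have diam: "diameter K < d" if KQ: "K \<in> Q" for K
  proof -
    obtain x where "(x, K) \<in> p" using KQ by (auto simp: Q_def)
    then have "K \<subseteq> ball x (d / 3)" using p(2) by (auto simp: fine_def)
    then have "diameter K \<le> diameter (ball x (d / 3))" by (intro diameter_subset) auto
    also have "\<dots> < d" using d by simp
    finally show ?thesis .
  qed
  define N where "N K k = real (card (X k \<inter> K)) / g k" for K k
  \<comment> \<open>Besides the discrepancy of the cells, \<open>err\<close> accounts for the points that are counted several
    times because the closed cells overlap.\<close>
  define err where "err k = B * (\<Sum>K\<in>Q. \<bar>N K k - measure lborel K\<bar>)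
      + B * ((\<Sum>K\<in>Q. N K k) - N (cbox a b) k)" for k
  have N: "N K \<longlonglongrightarrow> measure lborel K" if "K \<in> Q" for K
    using division_ofD(4)[OF Q that] dens by (auto simp: N_def[abs_def])
  have "err \<longlonglongrightarrow> B * (\<Sum>K\<in>Q. \<bar>measure lborel K - measure lborel K\<bar>)
      + B * ((\<Sum>K\<in>Q. measure lborel K) - measure lborel (cbox a b))"
    unfolding err_def using N dens[of a b] by (intro tendsto_intros) (auto simp: N_def[abs_def])
  \<comment> \<open>The overlap term vanishes in the limit since the volumes of the cells add up to
    that of the box.\<close>
  then have "err \<longlonglongrightarrow> 0" using additive_content_division[OF Q] by simp
  then have "\<forall>\<^sub>F k in sequentially. err k < e / 2" using e by (intro order_tendstoD(2)) auto
  then show "\<forall>\<^sub>F k in sequentially. dist ((\<Sum>u\<in>X k \<inter> cbox a b. f u) /\<^sub>R g k) I < e"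
  proof eventually_elim
    fix k assume err: "err k < e / 2"
    define U where "U K = X k \<inter> K" for K
    define z where "z = (\<Sum>u\<in>X k \<inter> cbox a b. f u) /\<^sub>R g k - I"
    \<comment> \<open>As \<open>inner (sgn z) z = norm z\<close>, also for \<open>z = 0\<close>,
      bounding \<open>norm z\<close> becomes a question about sums of the real function
      \<open>h\<close>.\<close>
    define h where "h x = inner (sgn z) (f x)" for x
    have hB: "\<bar>h x\<bar> \<le> B" for x
    proof -
      have "\<bar>h x\<bar> \<le> norm (sgn z) * norm (f x)" unfolding h_def by (rule Cauchy_Schwarz_ineq2)
      also have "\<dots> \<le> 1 * B" using B by (intro mult_mono) (auto simp: norm_sgn)
      finally show ?thesis by simp
    qed
    have finU: "finite (U K)" if "K \<in> Q" for K
      using UQ that by (intro finite_subset[OF _ fin[of k]]) (auto simp: U_def)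
    \<comment> \<open>In the direction of the error \<open>z\<close>, the average of \<open>f\<close> over the points in a cell is dominated by
      its value at a maximizing tag, so one Riemann sum bounds the norm of \<open>z\<close>.\<close>
    have "\<exists>x\<in>K. \<forall>u\<in>U K. h u \<le> h x" if KQ: "K \<in> Q" for K
    proof (cases "U K = {}")
      case True
      then show ?thesis using division_ofD(3)[OF Q that] by blast
    next
      case False
      then have "Max (h ` U K) \<in> h ` U K" using finU[OF KQ] by (intro Max_in) auto
      then obtain x where x: "x \<in> U K" "Max (h ` U K) = h x" by blast
      have "h u \<le> h x" if "u \<in> U K" for u
        unfolding x(2)[symmetric] using finU[OF KQ] that by (intro Max_ge) auto
      moreover have "x \<in> K" using x(1) by (simp add: U_def)
      ultimately show ?thesis by blast
    qed
    then obtain x where x: "\<And>K. K \<in> Q \<Longrightarrow> x K \<in> K" "\<And>K u. K \<in> Q \<Longrightarrow> u \<in> U K \<Longrightarrow> h u \<le> h (x K)"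
      by metis
    \<comment> \<open>Each cell carries a single tag, so distinct elements of \<open>P\<close> have
      distinct cells.\<close>
    define P where "P = (\<lambda>K. (x K, K)) ` Q"
    have "P tagged_division_of cbox a b"
    proof (rule tagged_division_ofI)
      show "finite P" using finQ by (simp add: P_def)
      show "interior K1 \<inter> interior K2 = {}"
        if "(x1, K1) \<in> P" "(x2, K2) \<in> P" "(x1, K1) \<noteq> (x2, K2)" for x1 K1 x2 K2
        using that by (intro division_ofD(5)[OF Q]) (auto simp: P_def)
      have "{K. \<exists>x. (x, K) \<in> P} = Q" by (auto simp: P_def)
      then show "\<Union> {K. \<exists>x. (x, K) \<in> P} = cbox a b" using UQ by simp
    qed (use x(1) division_ofD(2,4)[OF Q] in \<open>auto simp: P_def\<close>)
    moreover have "\<forall>(x, K)\<in>P. diameter K < d" using diam by (auto simp: P_def)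
    ultimately have "norm ((\<Sum>(x, K)\<in>P. measure lborel K *\<^sub>R f x) - I) < e / 2" by (rule D)
    moreover have "(\<Sum>(x, K)\<in>P. measure lborel K *\<^sub>R f x) = (\<Sum>K\<in>Q. measure lborel K *\<^sub>R f (x K))"
      unfolding P_def by (subst sum.reindex) (auto simp: inj_on_def)
    ultimately have R: "norm ((\<Sum>K\<in>Q. measure lborel K *\<^sub>R f (x K)) - I) < e / 2" by simp
    have "inner (sgn z) ((\<Sum>K\<in>Q. measure lborel K *\<^sub>R f (x K)) - I)
        \<le> norm (sgn z) * norm ((\<Sum>K\<in>Q. measure lborel K *\<^sub>R f (x K)) - I)"
      by (rule norm_cauchy_schwarz)
    also have "\<dots> \<le> 1 * norm ((\<Sum>K\<in>Q. measure lborel K *\<^sub>R f (x K)) - I)"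
      by (intro mult_right_mono) (auto simp: norm_sgn)
    finally have tags: "(\<Sum>K\<in>Q. measure lborel K * h (x K)) - inner (sgn z) I < e / 2"
      using R by (simp add: inner_diff_right inner_sum_right h_def)
    \<comment> \<open>Shifting by \<open>B\<close> makes the summands nonnegative, as
      \<open>sum_Union_le\<close> requires; the surplus becomes the overlap term of
      \<open>err\<close>.\<close>
    have hB0: "0 \<le> h u + B" for u using hB[of u] by linarith
    have "X k \<inter> cbox a b = (\<Union>K\<in>Q. U K)" using UQ by (auto simp: U_def)
    then have "(\<Sum>u\<in>X k \<inter> cbox a b. h u + B) \<le> (\<Sum>K\<in>Q. \<Sum>u\<in>U K. h u + B)"
      using sum_Union_le[where h = "\<lambda>u. h u + B" and U = U, OF finQ finU hB0] by simp
    also have "\<dots> \<le> (\<Sum>K\<in>Q. \<Sum>u\<in>U K. h (x K) + B)"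
      using x(2) by (intro sum_mono) auto
    finally have "(\<Sum>u\<in>X k \<inter> cbox a b. h u) + B * card (X k \<inter> cbox a b) \<le>
        (\<Sum>K\<in>Q. card (U K) * h (x K)) + B * (\<Sum>K\<in>Q. card (U K))"
      by (simp add: sum.distrib sum_distrib_left algebra_simps)
    \<comment> \<open>If \<open>g k = 0\<close>, both quotients are 0 and the inequality
      persists.\<close>
    then have "((\<Sum>u\<in>X k \<inter> cbox a b. h u) + B * card (X k \<inter> cbox a b)) / g k \<le>
        ((\<Sum>K\<in>Q. card (U K) * h (x K)) + B * (\<Sum>K\<in>Q. card (U K))) / g k"
      using g by (rule divide_right_mono)
    then have "(\<Sum>u\<in>X k \<inter> cbox a b. h u) / g k \<le>
        (\<Sum>K\<in>Q. N K k * h (x K)) + B * ((\<Sum>K\<in>Q. N K k) - N (cbox a b) k)"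
      by (simp add: N_def U_def add_divide_distrib sum_divide_distrib[symmetric] right_diff_distrib)
    \<comment> \<open>Replacing the share of points in a cell by its volume costs at most
      \<open>B\<close> times the discrepancy, since \<open>h\<close> is bounded by \<open>B\<close>
      in absolute value.\<close>
    also have "(\<Sum>K\<in>Q. N K k * h (x K)) \<le>
        (\<Sum>K\<in>Q. measure lborel K * h (x K) + B * \<bar>N K k - measure lborel K\<bar>)"
    proof (rule sum_mono)
      fix K
      have "(N K k - measure lborel K) * h (x K) \<le> \<bar>N K k - measure lborel K\<bar> * B"
        using hB[of "x K"] abs_ge_self[of "(N K k - measure lborel K) * h (x K)"]
          mult_left_mono[OF hB[of "x K"], of "\<bar>N K k - measure lborel K\<bar>"]
        by (simp add: abs_mult)
      then show "N K k * h (x K) \<le> measure lborel K * h (x K) + B * \<bar>N K k - measure lborel K\<bar>"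
        by (simp add: algebra_simps)
    qed
    finally have "(\<Sum>u\<in>X k \<inter> cbox a b. h u) / g k \<le> (\<Sum>K\<in>Q. measure lborel K * h (x K)) + err k"
      by (simp add: err_def sum.distrib sum_distrib_left)
    moreover have "norm z = (\<Sum>u\<in>X k \<inter> cbox a b. h u) / g k - inner (sgn z) I"
    proof -
      have "norm z = inner (sgn z) z"
        by (cases "z = 0") (simp_all add: sgn_div_norm power2_norm_eq_inner[symmetric] power2_eq_square)
      also have "\<dots> = (\<Sum>u\<in>X k \<inter> cbox a b. h u) / g k - inner (sgn z) I"
        by (subst (2) z_def) (simp add: inner_diff_right inner_sum_right h_def divide_inverse)
      finally show ?thesis .
    qed
    ultimately show "dist ((\<Sum>u\<in>X k \<inter> cbox a b. f u) /\<^sub>R g k) I < e"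
      using tags err by (simp add: dist_norm z_def)
  qed
qed

theorem theorem1p2:
  fixes D :: "(real ^ 'n) set" and f :: "real ^ 'n \<Rightarrow> complex"
  assumes "riemann_integrable (extend_by_zero D f)"
  shows "(\<lambda>k. 1 / of_nat (card (den_points k \<inter> half_open_cube :: (real ^ 'n) set)) *
              (\<Sum>\<^sub>\<infinity>u\<in>den_points k. extend_by_zero D f u))
           \<longlonglongrightarrow> integral UNIV (extend_by_zero D f)"
proof -
  let ?F = "extend_by_zero D f"
  obtain a b I where bdd: "bounded (range ?F)" and supp: "{x. ?F x \<noteq> 0} \<subseteq> cbox a b"
    and I: "has_riemann_integral ?F I a b"
    using assms unfolding riemann_integrable_def by blast
  have int: "integral UNIV ?F = I"
    using has_riemann_integral_imp_has_integral[OF I supp] by (rule integral_unique)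
  \<comment> \<open>\<open>?F\<close> vanishes outside the box, and the box contains only finitely
    many points of denominator \<open>k\<close>.\<close>
  have sum: "(\<Sum>\<^sub>\<infinity>u\<in>den_points k. ?F u) = (\<Sum>u\<in>den_points k \<inter> cbox a b. ?F u)" for k
  proof -
    have "(\<Sum>\<^sub>\<infinity>u\<in>den_points k. ?F u) = (\<Sum>\<^sub>\<infinity>u\<in>den_points k \<inter> cbox a b. ?F u)"
      using supp by (intro infsum_cong_neutral) auto
    then show ?thesis by (simp add: finite_den_points_cbox)
  qed
  have "(\<lambda>k. (\<Sum>u\<in>den_points k \<inter> cbox a b. ?F u)
      /\<^sub>R real (card (den_points k \<inter> half_open_cube :: (real ^ 'n) set))) \<longlonglongrightarrow> I"
    using I bdd of_nat_0_le_iff finite_den_points_cbox den_points_cbox_density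
    by (rule equidistributed_sums_tendsto_riemann_integral)
  then show ?thesis
    unfolding int sum by (simp add: scaleR_conv_of_real divide_inverse)
qed

end
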